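(* Let $n\ge 3$, let $a_1,\dots,a_n\in\mathbb{R}^n$ be linearly independent, and let $\alpha=\cos\theta\in\left(\frac{-1}{n-1},1\right)$ with $\theta\in(0,\pi)$. Put $s_1=a_1/\Vert a_1\Vert$, $u_2=a_2-s_1s_1^Ta_2$, $q_2=u_2/\Vert u_2\Vert$, $v_2=q_2+\cot\theta\, s_1$ and $s_2=v_2/\Vert v_2\Vert$. Successively for $k=2,\dots,n-1$, let $q_{k+1}\in\operatorname{span}\{s_1,\dots,s_k,a_{k+1}\}$ be a unit vector orthogonal to $s_1,\dots,s_k$, and put $$v_{k+1}=q_{k+1}+\left(\frac{\sqrt{k}\,\alpha}{\sqrt{(1-\alpha)(1+k\alpha)}}\right)\frac{\sum_{i=1}^{k}s_i}{\left\Vert\sum_{i=1}^{k}s_i\right\Vert},\qquad s_{k+1}=\frac{v_{k+1}}{\Vert v_{k+1}\Vert}.$$ Then for each $k$ with $2\le k<n$ the vector $s_{k+1}$ is the $(k+1)$th equiangular vector, i.e. $\Vert s_{k+1}\Vert=1$ and $s_{k+1}^Ts_i=\alpha$ for all $1\le i\le k$.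
   Context: $\mathbb{R}^n$ carries the standard inner product and $\Vert\cdot\Vert$ is the Euclidean norm. Vectors $s_1,\dots,s_m$ are called equiangular with $\alpha$ if $s_i^Ts_i=1$ for all $i$ and $s_i^Ts_j=\alpha$ for all $i\ne j$. *)

theory Defs
  imports "HOL-Analysis.Analysis"
begin

end

theory Submission
  imports Defs
begin

text \<open>
  Write $S$ for the sum of $k$ equiangular vectors and put $c = 1 + (k-1)\alpha$,
  $d = (1-\alpha)(1+k\alpha)$. Then $S \cdot s_i = c$ and $\|S\|^2 = kc$. The coefficient
  $\sqrt{k}\alpha/\sqrt{d}$ is chosen so that, by the identity $d + k\alpha^2 = c$,
  $\|v\|^2 = c/d$, while $v \cdot s_i = \alpha\sqrt{c/d}$. The initial step is the
  case $k = 1$, because $\cot\theta = \alpha/\sqrt{(1-\alpha)(1+\alpha)}$.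
\<close>

text \<open>An arbitrary index set lets a single extension lemma serve both \<open>{1}\<close> and
  \<open>{1..k}\<close>; distinctness is asked of indices, not of vectors.\<close>

definition equiangular_on :: "'i set \<Rightarrow> real \<Rightarrow> ('i \<Rightarrow> 'a::real_inner) \<Rightarrow> bool" where
  "equiangular_on I \<alpha> s \<longleftrightarrow>
    (\<forall>i\<in>I. norm (s i) = 1) \<and> (\<forall>i\<in>I. \<forall>j\<in>I. i \<noteq> j \<longrightarrow> s i \<bullet> s j = \<alpha>)"

lemma equiangular_on_insert:
  assumes "equiangular_on I \<alpha> s" and "norm (s j) = 1" and "\<And>i. i \<in> I \<Longrightarrow> s j \<bullet> s i = \<alpha>"
  shows "equiangular_on (insert j I) \<alpha> s"
  using assms by (auto simp: equiangular_on_def inner_commute)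

lemma equiangular_on_sum_inner:
  assumes "equiangular_on I \<alpha> s" and "finite I" and "i \<in> I"
  shows "(\<Sum>j\<in>I. s j) \<bullet> s i = 1 + (real (card I) - 1) * \<alpha>"
proof -
  \<comment> \<open>Positivity makes the truncated natural number \<open>card I - 1\<close> agree
    with the real difference.\<close>
  have "card I > 0"
    using assms by (auto simp: card_gt_0_iff)
  have "(\<Sum>j\<in>I. s j) \<bullet> s i = s i \<bullet> s i + (\<Sum>j\<in>I - {i}. s j \<bullet> s i)"
    using assms by (simp add: sum.remove[of I i] inner_add_left inner_sum_left)
  also have "s i \<bullet> s i = 1"
    using assms by (simp add: equiangular_on_def dot_square_norm)
  also have "(\<Sum>j\<in>I - {i}. s j \<bullet> s i) = (\<Sum>j\<in>I - {i}. \<alpha>)"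
    using assms by (intro sum.cong) (auto simp: equiangular_on_def)
  also have "\<dots> = (real (card I) - 1) * \<alpha>"
    using assms \<open>card I > 0\<close> by (simp add: of_nat_diff)
  finally show ?thesis .
qed

lemma equiangular_on_norm_sum:
  assumes "equiangular_on I \<alpha> s" and "finite I"
  shows "norm (\<Sum>j\<in>I. s j) = sqrt (real (card I) * (1 + (real (card I) - 1) * \<alpha>))"
proof -
  have "(\<Sum>j\<in>I. s j) \<bullet> (\<Sum>i\<in>I. s i) = (\<Sum>i\<in>I. (\<Sum>j\<in>I. s j) \<bullet> s i)"
    by (rule inner_sum_right)
  also have "\<dots> = real (card I) * (1 + (real (card I) - 1) * \<alpha>)"
    using equiangular_on_sum_inner[OF assms] by simp
  finally show ?thesis
    by (simp add: norm_eq_sqrt_inner)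
qed

text \<open>The sum of the \<open>s i\<close> has the same inner product with each of them, and
  \<open>q\<close> is orthogonal to all of them, so adding any multiple of the sum to
  \<open>q\<close> gives a vector with equal inner products. The coefficient tunes their common
  value after normalization to \<alpha>.\<close>

lemma equiangular_on_extend:
  fixes s :: "'i \<Rightarrow> 'a::real_inner" and I :: "'i set"
  defines "k \<equiv> real (card I)"
  assumes eq: "equiangular_on I \<alpha> s" and I: "finite I" "I \<noteq> {}"
    and \<alpha>: "\<alpha> < 1" "1 + k * \<alpha> > 0"
    and q: "norm q = 1" "\<And>i. i \<in> I \<Longrightarrow> orthogonal q (s i)"
    and v: "v = q + (sqrt k * \<alpha> / sqrt ((1 - \<alpha>) * (1 + k * \<alpha>))) *\<^sub>R
      ((\<Sum>i\<in>I. s i) /\<^sub>R norm (\<Sum>i\<in>I. s i))"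
  shows "norm (v /\<^sub>R norm v) = 1" and "\<And>i. i \<in> I \<Longrightarrow> (v /\<^sub>R norm v) \<bullet> s i = \<alpha>"
proof -
  define S where "S = (\<Sum>i\<in>I. s i)"
  define c where "c = 1 + (k - 1) * \<alpha>"
  define d where "d = (1 - \<alpha>) * (1 + k * \<alpha>)"
  define \<beta> where "\<beta> = sqrt k * \<alpha> / sqrt d"
  have k: "k > 0"
    using I by (simp add: k_def card_gt_0_iff)
  \<comment> \<open>This is \<open>c > 0\<close> rearranged. For \<alpha> \<ge> 0 it follows from
    \<alpha> < 1, for negative \<alpha> from \<open>1 + k * \<alpha> > 0\<close>.\<close>
  have "\<alpha> < 1 + k * \<alpha>"
    using \<alpha> k mult_nonneg_nonneg[of k \<alpha>] by linarith
  hence c: "c > 0"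
    by (simp add: c_def algebra_simps)
  have d: "d > 0"
    using \<alpha> by (simp add: d_def)
  have S: "norm S = sqrt (k * c)"
    using equiangular_on_norm_sum[OF eq I(1)] by (simp add: S_def k_def c_def)
  have v': "v = q + \<beta> *\<^sub>R (S /\<^sub>R norm S)"
    by (simp add: v S_def d_def \<beta>_def)
  have "orthogonal q S"
    unfolding S_def by (rule orthogonal_rvsum) (use I q in auto)
  hence "orthogonal q (\<beta> *\<^sub>R (S /\<^sub>R norm S))"
    by (simp add: orthogonal_clauses)
  hence "(norm v)\<^sup>2 = (norm q)\<^sup>2 + (norm (\<beta> *\<^sub>R (S /\<^sub>R norm S)))\<^sup>2"
    unfolding v' by (rule norm_add_Pythagorean)
  \<comment> \<open>\<open>S /\<^sub>R norm S\<close> is a unit vector because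
    \<open>k * c > 0\<close>; the absolute value stays since \<alpha>, hence \<beta>, may be
    negative.\<close>
  also have "norm (\<beta> *\<^sub>R (S /\<^sub>R norm S)) = \<bar>\<beta>\<bar>"
    using k c by (simp add: S abs_mult)
  also have "(norm q)\<^sup>2 + \<bar>\<beta>\<bar>\<^sup>2 = (d + k * \<alpha>\<^sup>2) / d"
    using k d q by (simp add: \<beta>_def power_mult_distrib power_divide add_divide_distrib)
  also have "d + k * \<alpha>\<^sup>2 = c"
    by (simp add: c_def d_def power2_eq_square algebra_simps)
  finally have "norm v = sqrt (c / d)"
    by (simp add: real_sqrt_unique)
  hence nv: "norm v = sqrt c / sqrt d"
    by (simp add: real_sqrt_divide)
  show "norm (v /\<^sub>R norm v) = 1"
    using c d nv by (cases "v = 0") auto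
  fix i assume i: "i \<in> I"
  have "v \<bullet> s i = \<beta> * (c / sqrt (k * c))"
    using q(2)[OF i] equiangular_on_sum_inner[OF eq I(1) i]
    by (simp add: v' S inner_add_left orthogonal_def divide_inverse flip: S_def k_def c_def)
  \<comment> \<open>The factor \<open>sqrt k\<close> in \<beta> cancels the one in
    \<open>sqrt (k * c)\<close>.\<close>
  also have "\<dots> = \<alpha> * (c / sqrt c) / sqrt d"
    using k by (simp add: \<beta>_def real_sqrt_mult)
  also have "\<dots> = \<alpha> * norm v"
    using c by (simp add: nv real_div_sqrt)
  finally show "(v /\<^sub>R norm v) \<bullet> s i = \<alpha>"
    using c d nv by simp
qed

theorem theorem2p1:
  fixes a s q v :: "nat \<Rightarrow> real ^ 'n"
    and u2 :: "real ^ 'n"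
    and n :: nat
    and \<alpha> \<theta> :: real
  assumes dim: "n = CARD('n)" and n: "n \<ge> 3"
    and indep: "inj_on a {1..n}" "independent (a ` {1..n})"
    and \<theta>: "\<theta> \<in> {0<..<pi}"
    and \<alpha>: "\<alpha> = cos \<theta>" "\<alpha> \<in> {-1 / (real n - 1)<..<1}"
    and s1: "s 1 = a 1 /\<^sub>R norm (a 1)"
    and u2: "u2 = a 2 - (s 1 \<bullet> a 2) *\<^sub>R s 1"
    and q2: "q 2 = u2 /\<^sub>R norm u2"
    and v2: "v 2 = q 2 + cot \<theta> *\<^sub>R s 1"
    and s2: "s 2 = v 2 /\<^sub>R norm (v 2)"
    and q_span: "\<And>k. 2 \<le> k \<Longrightarrow> k < n \<Longrightarrow> q (k + 1) \<in> span (s ` {1..k} \<union> {a (k + 1)})"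
    and q_norm: "\<And>k. 2 \<le> k \<Longrightarrow> k < n \<Longrightarrow> norm (q (k + 1)) = 1"
    and q_orth: "\<And>k i. 2 \<le> k \<Longrightarrow> k < n \<Longrightarrow> 1 \<le> i \<Longrightarrow> i \<le> k \<Longrightarrow> orthogonal (q (k + 1)) (s i)"
    and v: "\<And>k. 2 \<le> k \<Longrightarrow> k < n \<Longrightarrow>
      v (k + 1) = q (k + 1) + (sqrt (real k) * \<alpha> / sqrt ((1 - \<alpha>) * (1 + real k * \<alpha>))) *\<^sub>R
        ((\<Sum>i=1..k. s i) /\<^sub>R norm (\<Sum>i=1..k. s i))"
    and s: "\<And>k. 2 \<le> k \<Longrightarrow> k < n \<Longrightarrow> s (k + 1) = v (k + 1) /\<^sub>R norm (v (k + 1))"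
  shows "\<forall>k. 2 \<le> k \<and> k < n \<longrightarrow>
    norm (s (k + 1)) = 1 \<and> (\<forall>i. 1 \<le> i \<and> i \<le> k \<longrightarrow> s (k + 1) \<bullet> s i = \<alpha>)"
proof -
  \<comment> \<open>For negative \<alpha> the worst case is k = n - 1, where the bound is exactly
    the assumption \<alpha> > -1/(n-1).\<close>
  have step: "1 + real k * \<alpha> > 0" if "k < n" for k
  proof (cases "\<alpha> \<ge> 0")
    case False
    have "-1 < (real n - 1) * \<alpha>"
      using \<alpha>(2) n by (simp add: field_simps)
    also have "\<dots> \<le> real k * \<alpha>"
      using False that by (intro mult_right_mono_neg) auto
    finally show ?thesis by simp
  qed (simp add: add_pos_nonneg)
  have "a 1 \<noteq> 0"
    using indep(2) n by (metis atLeastAtMost_iff dependent_zero imageI le_refl order_trans one_le_numeral)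
  hence norm_s1: "norm (s 1) = 1"
    unfolding s1 by simp
  have "u2 \<noteq> 0"
  proof
    assume "u2 = 0"
    hence "a 2 = (s 1 \<bullet> a 2) *\<^sub>R (a 1 /\<^sub>R norm (a 1))"
      unfolding u2 s1[symmetric] by simp
    hence "a 2 = ((s 1 \<bullet> a 2) / norm (a 1)) *\<^sub>R a 1"
      by (simp add: divide_inverse)
    \<comment> \<open>Independence concerns the image set, so injectivity is what keeps
      \<open>a 1\<close> in it after \<open>a 2\<close> is removed.\<close>
    moreover have "a 1 \<in> a ` {1..n} - {a 2}"
      using inj_onD[OF indep(1), of 1 2] n by auto
    ultimately have "a 2 \<in> span (a ` {1..n} - {a 2})"
      by (metis span_base span_scale)
    moreover have "a 2 \<in> a ` {1..n}"
      using n by auto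
    ultimately show False
      using indep(2) by (auto simp: dependent_def)
  qed
  hence norm_q2: "norm (q 2) = 1"
    by (simp add: q2)
  have "u2 \<bullet> s 1 = 0"
    using norm_s1 by (simp add: u2 inner_diff_left inner_diff_right dot_square_norm inner_commute)
  hence orth_q2: "orthogonal (q 2) (s 1)"
    by (simp add: q2 orthogonal_def)
  \<comment> \<open>The sign is needed to read the square root of
    \<open>(sin \<theta>)\<^sup>2\<close> as \<open>sin \<theta>\<close> rather than its
    negative.\<close>
  have "sin \<theta> > 0"
    using \<theta> by (simp add: sin_gt_zero)
  moreover have "(1 - \<alpha>) * (1 + \<alpha>) = (sin \<theta>)\<^sup>2"
    by (simp add: \<alpha>(1) sin_squared_eq power2_eq_square algebra_simps)
  ultimately have cot: "cot \<theta> = \<alpha> / sqrt ((1 - \<alpha>) * (1 + \<alpha>))"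
    by (simp add: cot_def \<alpha>(1))
  have next_vec: "norm (s (k + 1)) = 1 \<and> (\<forall>i\<in>{1..k}. s (k + 1) \<bullet> s i = \<alpha>)"
    if k: "1 \<le> k" "k < n" and eq: "equiangular_on {1..k} \<alpha> s" for k
  proof (cases "k = 1")
    case True
    have eq1: "equiangular_on {1} \<alpha> s"
      using norm_s1 by (simp add: equiangular_on_def)
    \<comment> \<open>Since \<open>s 1\<close> is a unit vector, the normalized sum over
      \<open>{1}\<close> is \<open>s 1\<close> itself, and the general coefficient at k = 1 is
      \<open>cot \<theta>\<close>.\<close>
    have v2': "v 2 = q 2 + (sqrt (real (card {1::nat})) * \<alpha> /
        sqrt ((1 - \<alpha>) * (1 + real (card {1::nat}) * \<alpha>))) *\<^sub>R
        ((\<Sum>i\<in>{1}. s i) /\<^sub>R norm (\<Sum>i\<in>{1}. s i))"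
      using norm_s1 by (simp add: v2 cot)
    have "1 + real (card {1::nat}) * \<alpha> > 0"
      using step[OF k(2)] True by simp
    from equiangular_on_extend[OF eq1 _ _ _ this norm_q2 _ v2']
    have "norm (s 2) = 1 \<and> s 2 \<bullet> s 1 = \<alpha>"
      using \<alpha>(2) orth_q2 unfolding s2 by auto
    moreover have "k + 1 = 2" "{1..k} = {1}"
      using True by auto
    ultimately show ?thesis
      by (metis singletonD)
  next
    case False
    with k have k2: "2 \<le> k" by simp
    have "1 + real (card {1..k}) * \<alpha> > 0"
      using step[OF k(2)] by simp
    from equiangular_on_extend[OF eq _ _ _ this q_norm[OF k2 k(2)], of "v (k + 1)"] show ?thesis
      using \<alpha>(2) k q_orth[OF k2 k(2)] v[OF k2 k(2)] unfolding s[OF k2 k(2)] by simp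
  qed
  \<comment> \<open>Induction discharges the assumption of \<open>next_vec\<close> that the first k
    vectors are already equiangular; \<open>next_vec\<close> then yields the claim for each k <
    n.\<close>
  have "equiangular_on {1..k} \<alpha> s" if "1 \<le> k" "k \<le> n" for k
    using that
  proof (induction k rule: nat_induct_at_least)
    case base
    show ?case
      using norm_s1 by (simp add: equiangular_on_def)
  next
    case (Suc k)
    hence eq: "equiangular_on {1..k} \<alpha> s" by simp
    have "equiangular_on (insert (k + 1) {1..k}) \<alpha> s"
      using next_vec[OF _ _ eq] Suc by (intro equiangular_on_insert[OF eq]) auto
    thus ?case
      by (simp add: atLeastAtMostSuc_conv)
  qed
  with next_vec show ?thesis
    by auto
qed

end
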